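(* Let $n\geq 2$ and $p\geq 2$ be natural numbers. Let $t=h^n_{1,k_1}\ldots h^n_{n-1,k_{n-1}}$ and $t'=h^n_{1,k'_1}\ldots h^n_{n-1,k'_{n-1}}$ be two expressions in normal form such that $t'$ precedes $t$ in the lexicographical order. Then no diagonal of $t$ is a pair of $t'$; that is, no diagonal of $t$ belongs to the binary relation denoted by $t'$.
   Context: Matrices and relations. $E_p$ is the $1\times p^2$ matrix with entries $E_p(1,(i-1)p+j)=\delta(i,j)$ for $1\le i,j\le p$ ($\delta$ is the Kronecker delta), and $E_p'$ is its transpose. For $1\le i\le n-1$, $h^n_i$ denotes the $p^n\times p^n$ 0-1 matrix $I_{p^{n-i-1}}\otimes E_p'E_p\otimes I_{p^{i-1}}$, where $I_m$ is the $m\times m$ identity matrix and $\otimes$ is the Kronecker product with the usual convention that $A\otimes B$ is the block matrix with blocks $A(a,b)B$. $\mathbf{1}^n$ denotes $I_{p^n}$. A 0-1 matrix $A$ is identified with the binary relation $\{(a,b)\mid A(a,b)=1\}$; thus $\mathbf{1}^n$ and the $h^n_i$ are binary relations on $\{1,\ldots,p^n\}$. Products of such expressions denote composites of relations: $(a,c)\in xy$ iff there is $b$ with $(a,b)\in x$ and $(b,c)\in y$. Blocks and normal form. $h^n_{i,0}$ is $\mathbf{1}^n$, $h^n_{i,1}$ is $h^n_i$, and for $2\le k\le i$, $h^n_{i,k}$ is $h^n_{i,k-1}h^n_{i-k+1}$ (so $h^n_{i,k}=h^n_ih^n_{i-1}\cdots h^n_{i-k+1}$ for $k\geq 1$). The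 expressions $h^n_{i,k}$, $0\le k\le i$, $1\le i\le n-1$, are called blocks. An expression $h^n_{1,k_1}\ldots h^n_{n-1,k_{n-1}}$ is in normal form if $0\le k_i\le i$ for every $i$, and whenever $i<j$ and $k_i,k_j>0$ we have $i-k_i<j-k_j$. Lexicographical order. $h^n_{1,k'_1}\ldots h^n_{n-1,k'_{n-1}}$ precedes $h^n_{1,k_1}\ldots h^n_{n-1,k_{n-1}}$ iff for some $i$ we have $k'_i<k_i$ and for every $j>i$ we have $k'_j=k_j$. $S$-words. $S$-words are words in the alphabet $\{S_q\mid 1\le q\le p\}$; $|W|$ is the length of $W$; $W^0$ is the empty word and $W^{m+1}=W^mW$. For $m,k\ge 0$ let $A^m_k=\{k+1,\ldots,k+p^m\}$ and for $1\le q\le p$ let $S_qA^{m+1}_k=\{(q-1)p^m+j\mid j\in A^m_k\}$; words act by successive application, the rightmost letter being applied first (e.g. $S_1S_2A^2_0=S_1(S_2A^2_0)$). For $|W|=n$ the set $WA^n_0$ is a singleton, identified with its element; explicitly, $S_{q_1}S_{q_2}\cdots S_{q_n}$ stands for the number $1+\sum_{j=1}^n(q_j-1)p^{j-1}$. For $S$-words $W_1,W_2$ of length $n$, $(W_1,W_2)$ abbreviates $(W_1A^n_0,W_2A^n_0)$. Fix $q_1\neq q_2$ in $\{1,\ldots,p\}$ and let $L$ be short for $S_{q_1}$ and $R$ for $S_{q_2}$. Diagonals of blocks. The diagonals of $h^n_{i,k}$ for $1\le k\le i$ are the pairs of the following forms, where $V,W$ are arbitrary $S$-words with $|V|=i-k$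 and $|W|=n-i-1$: for $k=2l$, the pairs $(V(RL)^lLW,\;VL(LR)^lW)$ and $(V(LR)^lRW,\;VR(RL)^lW)$; for $k=2l+1$, the pairs $(V(LR)^lLLW,\;VRR(LR)^lW)$ and $(V(RL)^lRRW,\;VLL(RL)^lW)$. For $k=0$, all the pairs of the identity relation $\mathbf{1}^n$ are diagonals of $h^n_{i,0}$. Diagonals of products. For an expression $h^n_{1,k_1}\ldots h^n_{n-1,k_{n-1}}$ in normal form, the diagonals of $h^n_{1,k_1}\ldots h^n_{i,k_i}$ are defined inductively: for $i=1$ they are the diagonals of the block $h^n_{1,k_1}$; and if $(W_1,W_2)$ is a diagonal of $h^n_{1,k_1}\ldots h^n_{j,k_j}$ with $j<n-1$, and $(W_2,W_3)$ is a diagonal of $h^n_{j+1,k_{j+1}}$, then $(W_1,W_3)$ is a diagonal of $h^n_{1,k_1}\ldots h^n_{j+1,k_{j+1}}$ (and all its diagonals arise in this way). *)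

theory Defs
  imports "Jordan_Normal_Form.Matrix"
begin

subsection \<open>Matrices and relations\<close>

definition kronecker :: "'a::semiring_0 mat \<Rightarrow> 'a mat \<Rightarrow> 'a mat"  (infixl "\<otimes>\<^sub>K" 70) where
  "A \<otimes>\<^sub>K B = mat (dim_row A * dim_row B) (dim_col A * dim_col B)
     (\<lambda>(i, j). A $$ (i div dim_row B, j div dim_col B) * B $$ (i mod dim_row B, j mod dim_col B))"

text \<open>Matrix positions count from 0 here: for \<open>i, j < p\<close> the entry at column
  \<open>i * p + j\<close> is the Kronecker delta of \<open>i\<close> and \<open>j\<close>.\<close>

definition E_mat :: "nat \<Rightarrow> nat mat" where
  "E_mat p = mat 1 (p ^ 2) (\<lambda>(_, c). if c div p = c mod p then 1 else 0)"

definition h_mat :: "nat \<Rightarrow> nat \<Rightarrow> nat \<Rightarrow> nat mat" where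
  "h_mat p n i =
     1\<^sub>m (p ^ (n - i - 1)) \<otimes>\<^sub>K (transpose_mat (E_mat p) * E_mat p) \<otimes>\<^sub>K 1\<^sub>m (p ^ (i - 1))"

text \<open>The relation of a 0-1 matrix lives on indices counted from 1.\<close>

definition rel_of_mat :: "nat mat \<Rightarrow> (nat \<times> nat) set" where
  "rel_of_mat A =
     {(a, b). a \<in> {1..dim_row A} \<and> b \<in> {1..dim_col A} \<and> A $$ (a - 1, b - 1) = 1}"

definition one_rel :: "nat \<Rightarrow> nat \<Rightarrow> (nat \<times> nat) set" where
  "one_rel p n = rel_of_mat (1\<^sub>m (p ^ n))"

definition h_rel :: "nat \<Rightarrow> nat \<Rightarrow> nat \<Rightarrow> (nat \<times> nat) set" where
  "h_rel p n i = rel_of_mat (h_mat p n i)"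

lemma one_rel_eq: "one_rel p n = Id_on {1..p ^ n}"
proof -
  have "(a, b) \<in> one_rel p n \<longleftrightarrow> a \<in> {1..p ^ n} \<and> b = a" for a b
  proof (cases "a \<in> {1..p ^ n} \<and> b \<in> {1..p ^ n}")
    case True
    then have "a - 1 = b - 1 \<longleftrightarrow> b = a"
      unfolding atLeastAtMost_iff by linarith
    moreover have "a - 1 < p ^ n" "b - 1 < p ^ n"
      using True unfolding atLeastAtMost_iff by linarith+
    ultimately show ?thesis
      using True by (simp add: one_rel_def rel_of_mat_def)
  next
    case False
    then show ?thesis
      by (auto simp: one_rel_def rel_of_mat_def)
  qed
  then show ?thesis
    by (auto simp: Id_on_def)
qed

subsection \<open>Blocks, normal form, lexicographical order\<close>

text \<open>Composition \<open>(O)\<close> is in diagrammatic order, so it is the product of the relations as written.\<close>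

fun block_rel :: "nat \<Rightarrow> nat \<Rightarrow> nat \<Rightarrow> nat \<Rightarrow> (nat \<times> nat) set" where
  "block_rel p n i 0 = one_rel p n"
| "block_rel p n i (Suc 0) = h_rel p n i"
| "block_rel p n i (Suc (Suc k)) =
     block_rel p n i (Suc k) O h_rel p n (i - Suc (Suc k) + 1)"

text \<open>An expression in the blocks with indices 1 to \<open>n - 1\<close> is given by its exponents
  \<open>k :: nat \<Rightarrow> nat\<close>; only the values \<open>k i\<close> with \<open>1 \<le> i \<le> n - 1\<close> are relevant. The relation
  below is that of the product of the first \<open>i\<close> blocks; the empty product is the identity.\<close>

fun product_rel :: "nat \<Rightarrow> nat \<Rightarrow> (nat \<Rightarrow> nat) \<Rightarrow> nat \<Rightarrow> (nat \<times> nat) set" where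
  "product_rel p n k 0 = one_rel p n"
| "product_rel p n k (Suc 0) = block_rel p n 1 (k 1)"
| "product_rel p n k (Suc (Suc i)) =
     product_rel p n k (Suc i) O block_rel p n (Suc (Suc i)) (k (Suc (Suc i)))"

definition normal_form :: "nat \<Rightarrow> (nat \<Rightarrow> nat) \<Rightarrow> bool" where
  "normal_form n k \<longleftrightarrow>
     (\<forall>i\<in>{1..n - 1}. k i \<le> i) \<and>
     (\<forall>i\<in>{1..n - 1}. \<forall>j\<in>{1..n - 1}.
        i < j \<and> 0 < k i \<and> 0 < k j \<longrightarrow> i - k i < j - k j)"

definition precedes :: "nat \<Rightarrow> (nat \<Rightarrow> nat) \<Rightarrow> (nat \<Rightarrow> nat) \<Rightarrow> bool" where
  "precedes n k' k \<longleftrightarrow>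
     (\<exists>i\<in>{1..n - 1}. k' i < k i \<and> (\<forall>j\<in>{1..n - 1}. i < j \<longrightarrow> k' j = k j))"

subsection \<open>S-words\<close>

text \<open>The letter \<open>S\<^sub>q\<close> is represented by its index \<open>q\<close>.\<close>

definition S_words :: "nat \<Rightarrow> nat \<Rightarrow> nat list set" where
  "S_words p m = {W. length W = m \<and> set W \<subseteq> {1..p}}"

primrec word_pow :: "'a list \<Rightarrow> nat \<Rightarrow> 'a list" where
  "word_pow W 0 = []"
| "word_pow W (Suc m) = word_pow W m @ W"

definition A_set :: "nat \<Rightarrow> nat \<Rightarrow> nat \<Rightarrow> nat set" where
  "A_set p m k = {k + 1..k + p ^ m}"

text \<open>For \<open>p \<ge> 2\<close> the set \<open>A_set p (Suc m) k\<close> determines \<open>m\<close> and \<open>k\<close>.\<close>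

definition S_act :: "nat \<Rightarrow> nat \<Rightarrow> nat set \<Rightarrow> nat set" where
  "S_act p q X = {(q - 1) * p ^ m + j | m k j. X = A_set p (Suc m) k \<and> j \<in> A_set p m k}"

definition word_val :: "nat \<Rightarrow> nat list \<Rightarrow> nat" where
  "word_val p W = the_elem (foldr (S_act p) W (A_set p (length W) 0))"

lemma A_set_eq_iff:
  assumes "2 \<le> p"
  shows "A_set p m k = A_set p m' k' \<longleftrightarrow> m = m' \<and> k = k'"
proof
  assume eq: "A_set p m k = A_set p m' k'"
  have "k + 1 \<le> k + p ^ m" "k' + 1 \<le> k' + p ^ m'"
    using assms by simp_all
  then have "k = k'" "k + p ^ m = k' + p ^ m'"
    using eq unfolding A_set_def Icc_eq_Icc by auto
  then show "m = m' \<and> k = k'"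
    using assms by (simp add: power_inject_exp)
qed simp

lemma S_act_A_set:
  assumes "2 \<le> p"
  shows "S_act p q (A_set p (Suc m) k) = A_set p m (k + (q - 1) * p ^ m)"
proof -
  have "S_act p q (A_set p (Suc m) k) = (+) ((q - 1) * p ^ m) ` A_set p m k"
    using assms by (auto simp: S_act_def A_set_eq_iff)
  also have "\<dots> = A_set p m (k + (q - 1) * p ^ m)"
    by (simp only: A_set_def image_add_atLeastAtMost add_ac)
  finally show ?thesis .
qed

lemma foldr_S_act_A_set:
  assumes "2 \<le> p"
  shows "foldr (S_act p) W (A_set p (length W + r) k) =
           A_set p r (k + (\<Sum>j<length W. (W ! j - 1) * p ^ (j + r)))"
proof (induction W arbitrary: r)
  case Nil
  then show ?case by simp
next
  case (Cons q W)
  have "foldr (S_act p) (q # W) (A_set p (length (q # W) + r) k) =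
      S_act p q (A_set p (Suc r) (k + (\<Sum>j<length W. (W ! j - 1) * p ^ (j + Suc r))))"
    using Cons.IH[of "Suc r"] by simp
  also have "\<dots> = A_set p r (k + (\<Sum>j<length W. (W ! j - 1) * p ^ (j + Suc r)) + (q - 1) * p ^ r)"
    using assms by (rule S_act_A_set)
  also have "k + (\<Sum>j<length W. (W ! j - 1) * p ^ (j + Suc r)) + (q - 1) * p ^ r =
      k + (\<Sum>j<length (q # W). ((q # W) ! j - 1) * p ^ (j + r))"
    unfolding list.size(4) add_0_right add_Suc_right sum.lessThan_Suc_shift by simp
  finally show ?case .
qed

lemma word_val_eq:
  assumes "2 \<le> p"
  shows "word_val p W = 1 + (\<Sum>j<length W. (W ! j - 1) * p ^ j)"
proof -
  have "A_set p 0 m = {m + 1}" for m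
    by (simp add: A_set_def)
  then show ?thesis
    using foldr_S_act_A_set[OF assms, of W 0 0]
    by (simp only: word_val_def add_0_right add_0_left the_elem_eq add.commute)
qed

subsection \<open>Diagonals\<close>

inductive block_diagonal ::
  "nat \<Rightarrow> nat \<Rightarrow> nat \<Rightarrow> nat \<Rightarrow> nat \<Rightarrow> nat \<Rightarrow> nat \<times> nat \<Rightarrow> bool"
  for p n q1 q2 i k where
  zero: "k = 0 \<Longrightarrow> d \<in> one_rel p n \<Longrightarrow> block_diagonal p n q1 q2 i k d"
| even_RL: "1 \<le> k \<Longrightarrow> k \<le> i \<Longrightarrow> k = 2 * l \<Longrightarrow> L = [q1] \<Longrightarrow> R = [q2] \<Longrightarrow>
     V \<in> S_words p (i - k) \<Longrightarrow> W \<in> S_words p (n - i - 1) \<Longrightarrow>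
     block_diagonal p n q1 q2 i k
       (word_val p (V @ word_pow (R @ L) l @ L @ W),
        word_val p (V @ L @ word_pow (L @ R) l @ W))"
| even_LR: "1 \<le> k \<Longrightarrow> k \<le> i \<Longrightarrow> k = 2 * l \<Longrightarrow> L = [q1] \<Longrightarrow> R = [q2] \<Longrightarrow>
     V \<in> S_words p (i - k) \<Longrightarrow> W \<in> S_words p (n - i - 1) \<Longrightarrow>
     block_diagonal p n q1 q2 i k
       (word_val p (V @ word_pow (L @ R) l @ R @ W),
        word_val p (V @ R @ word_pow (R @ L) l @ W))"
| odd_LR: "1 \<le> k \<Longrightarrow> k \<le> i \<Longrightarrow> k = 2 * l + 1 \<Longrightarrow> L = [q1] \<Longrightarrow> R = [q2] \<Longrightarrow>
     V \<in> S_words p (i - k) \<Longrightarrow> W \<in> S_words p (n - i - 1) \<Longrightarrow>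
     block_diagonal p n q1 q2 i k
       (word_val p (V @ word_pow (L @ R) l @ L @ L @ W),
        word_val p (V @ R @ R @ word_pow (L @ R) l @ W))"
| odd_RL: "1 \<le> k \<Longrightarrow> k \<le> i \<Longrightarrow> k = 2 * l + 1 \<Longrightarrow> L = [q1] \<Longrightarrow> R = [q2] \<Longrightarrow>
     V \<in> S_words p (i - k) \<Longrightarrow> W \<in> S_words p (n - i - 1) \<Longrightarrow>
     block_diagonal p n q1 q2 i k
       (word_val p (V @ word_pow (R @ L) l @ R @ R @ W),
        word_val p (V @ L @ L @ word_pow (R @ L) l @ W))"

text \<open>The diagonals of the product of the first \<open>i \<ge> 1\<close> blocks.\<close>

inductive product_diagonal ::
  "nat \<Rightarrow> nat \<Rightarrow> nat \<Rightarrow> nat \<Rightarrow> (nat \<Rightarrow> nat) \<Rightarrow> nat \<Rightarrow> nat \<times> nat \<Rightarrow> bool"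
  for p n q1 q2 k where
  first: "block_diagonal p n q1 q2 1 (k 1) d \<Longrightarrow> product_diagonal p n q1 q2 k 1 d"
| step: "product_diagonal p n q1 q2 k j (w1, w2) \<Longrightarrow> j < n - 1 \<Longrightarrow>
     block_diagonal p n q1 q2 (j + 1) (k (j + 1)) (w2, w3) \<Longrightarrow>
     product_diagonal p n q1 q2 k (j + 1) (w1, w3)"

end

theory Submission
  imports Defs
begin

text \<open>Identify a number with its word of base-\<open>p\<close> digits. A pair of \<open>h\<^sub>i\<close> agrees outside
  positions \<open>i\<close>, \<open>i + 1\<close> and carries a double letter there on both sides, so a pair \<open>(a, b)\<close> of the
  block \<open>h\<^sub>i\<^sub>,\<^sub>k\<close> is determined by \<open>b\<close> and the last letter of \<open>a\<close> that the block can change, and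
  \<open>b\<close> has a double letter at \<open>i - k + 1\<close>. In a diagonal of the block the right-hand word alternates
  from \<open>i - k + 2\<close> on, and the letters at \<open>i + 1\<close> differ. The blocks with smaller index do not
  touch position \<open>i + 1\<close>. Peeling off equal last blocks therefore forces the intermediate words of
  the two factorisations to coincide; at the last block where the exponents differ, \<open>k' = 0\<close>
  contradicts the change at \<open>i + 1\<close>, and \<open>0 < k' < k\<close> requires a double letter inside the
  alternating part.\<close>

subsection \<open>Digits\<close>

text \<open>Digit positions count from 0: \<open>digit p a j\<close> belongs to the letter with index \<open>j + 1\<close>.\<close>

definition digit :: "nat \<Rightarrow> nat \<Rightarrow> nat \<Rightarrow> nat" where
  "digit p a j = (a - 1) div p ^ j mod p"

text \<open>By induction the remainders modulo every \<open>p ^ j\<close> agree, and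
  \<open>j = n\<close> suffices because \<open>a - 1\<close> and \<open>b - 1\<close> are below
  \<open>p ^ n\<close>.\<close>

lemma digits_eq_imp_eq:
  assumes "a \<in> {1..p ^ n}" and "b \<in> {1..p ^ n}" and "\<And>j. digit p a j = digit p b j"
  shows "a = b"
proof -
  have "(a - 1) mod p ^ j = (b - 1) mod p ^ j" for j
  proof (induction j)
    case (Suc j)
    have "x mod p ^ Suc j = p ^ j * (x div p ^ j mod p) + x mod p ^ j" for x
      using mod_mult2_eq[of x "p ^ j" p] by (simp add: mult.commute)
    then show ?case
      using Suc assms(3)[of j] by (simp add: digit_def)
  qed simp
  moreover have "a - 1 < p ^ n" "b - 1 < p ^ n"
    using assms(1,2) by auto
  ultimately have "a - 1 = b - 1"
    by (metis mod_less)
  moreover have "1 \<le> a" "1 \<le> b"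
    using assms(1,2) by auto
  ultimately show ?thesis
    by linarith
qed

text \<open>The first letter is the lowest digit: the number minus one is \<open>q - 1\<close> plus
  \<open>p\<close> times the same quantity for the rest, and \<open>q - 1 < p\<close> excludes a
  carry.\<close>

lemma digit_word_val:
  assumes "2 \<le> p" and "set U \<subseteq> {1..p}" and "j < length U"
  shows "digit p (word_val p U) j = U ! j - 1"
  using assms(2,3)
proof (induction U arbitrary: j)
  case (Cons q U)
  let ?s = "\<Sum>i<length U. (U ! i - 1) * p ^ i"
  have val: "word_val p (q # U) - 1 = (q - 1) + p * ?s"
    unfolding word_val_eq[OF assms(1)] list.size(4) add_0_right add_Suc_right
      sum.lessThan_Suc_shift
    by (simp add: sum_distrib_left mult_ac)
  have s: "word_val p U - 1 = ?s"
    by (simp add: word_val_eq[OF assms(1)])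
  have q: "q - 1 < p"
    using Cons.prems(1) assms(1) by auto
  show ?case
  proof (cases j)
    case 0
    then show ?thesis
      using q unfolding digit_def val by simp
  next
    case (Suc j')
    have "(q - 1 + p * ?s) div p ^ Suc j' = ?s div p ^ j'"
      using q assms(1) by (simp add: div_mult2_eq)
    then show ?thesis
      using Cons.IH[of j'] Cons.prems Suc unfolding digit_def val s by simp
  qed
qed simp

lemma word_val_range:
  assumes "2 \<le> p" and "set U \<subseteq> {1..p}"
  shows "word_val p U \<in> {1..p ^ length U}"
  using assms(2)
proof (induction U)
  case Nil
  then show ?case
    by (simp add: word_val_eq[OF assms(1)])
next
  case (Cons q U)
  have val: "word_val p (q # U) = q + p * (word_val p U - 1)"
    using Cons.prems
    unfolding word_val_eq[OF assms(1)] list.size(4) add_0_right add_Suc_right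
      sum.lessThan_Suc_shift
    by (simp add: sum_distrib_left mult_ac)
  have "word_val p U - 1 + 1 \<le> p ^ length U"
    using Cons by auto
  then have "p * (word_val p U - 1 + 1) \<le> p * p ^ length U"
    by (rule mult_le_mono2)
  then show ?case
    using Cons.prems unfolding val by (simp add: algebra_simps)
qed

subsection \<open>Pairs of blocks and products\<close>

lemma dim_h_mat:
  assumes "1 \<le> i" and "i < n"
  shows "dim_row (h_mat p n i) = p ^ n" and "dim_col (h_mat p n i) = p ^ n"
proof -
  have "p ^ (n - i - 1) * p\<^sup>2 * p ^ (i - 1) = p ^ (n - i - 1 + 2 + (i - 1))"
    by (simp only: power_add)
  also have "n - i - 1 + 2 + (i - 1) = n"
    using assms by simp
  finally have "p ^ (n - i - 1) * p\<^sup>2 * p ^ (i - 1) = p ^ n" .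
  then show "dim_row (h_mat p n i) = p ^ n" "dim_col (h_mat p n i) = p ^ n"
    by (simp_all add: h_mat_def kronecker_def E_mat_def)
qed

lemma index_kronecker:
  assumes "x < dim_row A * dim_row B" and "y < dim_col A * dim_col B"
  shows "(A \<otimes>\<^sub>K B) $$ (x, y) =
    A $$ (x div dim_row B, y div dim_col B) * B $$ (x mod dim_row B, y mod dim_col B)"
  using assms by (simp add: kronecker_def)

text \<open>The three Kronecker factors see disjoint groups of digits: the right identity those
  below \<open>i - 1\<close>, the middle factor the digits \<open>i - 1\<close> and
  \<open>i\<close>, the left identity those above. An entry is 1 only if each factor contributes
  1.\<close>

lemma h_rel_digits:
  assumes p: "0 < p" and i: "1 \<le> i" "i < n" and ab: "(a, b) \<in> h_rel p n i"
  shows "a \<in> {1..p ^ n}" and "b \<in> {1..p ^ n}"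
    and "digit p a (i - 1) = digit p a i" and "digit p b (i - 1) = digit p b i"
    and "\<And>j. j < i - 1 \<or> i < j \<Longrightarrow> digit p a j = digit p b j"
proof -
  show ra: "a \<in> {1..p ^ n}" and rb: "b \<in> {1..p ^ n}"
    using ab dim_h_mat[OF i, of p] by (auto simp: h_rel_def rel_of_mat_def)
  define x y where "x = a - 1" and "y = b - 1"
  define P where "P = p ^ (i - 1)"
  define Q where "Q = p ^ (n - i - 1)"
  have P: "0 < P"
    using p by (simp add: P_def)
  have "Q * p\<^sup>2 * P = p ^ (n - i - 1 + 2 + (i - 1))"
    by (simp only: power_add P_def Q_def)
  also have "n - i - 1 + 2 + (i - 1) = n"
    using i by simp
  finally have QP: "Q * p\<^sup>2 * P = p ^ n" .
  have x: "x < Q * p\<^sup>2 * P" and y: "y < Q * p\<^sup>2 * P"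
    using ra rb unfolding QP x_def y_def by auto
  then have x': "x div P < Q * p\<^sup>2" and y': "y div P < Q * p\<^sup>2"
    by (auto intro: less_mult_imp_div_less)
  then have x'': "x div P div p\<^sup>2 < Q" and y'': "y div P div p\<^sup>2 < Q"
    by (auto intro: less_mult_imp_div_less)
  let ?F = "transpose_mat (E_mat p) * E_mat p"
  \<comment> \<open>The matrix has rank one, so its entry splits into a condition on the two digits
    of \<open>c\<close> and the same condition on those of \<open>d\<close>.\<close>
  have F: "?F $$ (c, d) =
      (if c div p = c mod p then 1 else 0) * (if d div p = d mod p then 1 else 0)"
    if "c < p\<^sup>2" "d < p\<^sup>2" for c d
    using that by (simp add: E_mat_def scalar_prod_def)
  have one: "h_mat p n i $$ (x, y) = 1"
    using ab by (simp add: h_rel_def rel_of_mat_def x_def y_def)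
  have dims: "dim_col (E_mat p) = p\<^sup>2" "dim_row ?F = p\<^sup>2" "dim_col ?F = p\<^sup>2"
      "dim_row (1\<^sub>m Q \<otimes>\<^sub>K ?F) = Q * p\<^sup>2" "dim_col (1\<^sub>m Q \<otimes>\<^sub>K ?F) = Q * p\<^sup>2"
    by (simp_all add: kronecker_def E_mat_def)
  have "h_mat p n i $$ (x, y) =
      (1\<^sub>m Q \<otimes>\<^sub>K ?F) $$ (x div P, y div P) * 1\<^sub>m P $$ (x mod P, y mod P)"
    using x y unfolding h_mat_def P_def[symmetric] Q_def[symmetric]
    by (subst index_kronecker) (simp_all add: dims)
  also have "(1\<^sub>m Q \<otimes>\<^sub>K ?F) $$ (x div P, y div P) =
      1\<^sub>m Q $$ (x div P div p\<^sup>2, y div P div p\<^sup>2) *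
      ?F $$ (x div P mod p\<^sup>2, y div P mod p\<^sup>2)"
    using x' y' by (subst index_kronecker) (simp_all add: dims)
  finally have prod: "1\<^sub>m Q $$ (x div P div p\<^sup>2, y div P div p\<^sup>2) *
      ?F $$ (x div P mod p\<^sup>2, y div P mod p\<^sup>2) * 1\<^sub>m P $$ (x mod P, y mod P) = 1"
    using one by simp
  have high: "x div P div p\<^sup>2 = y div P div p\<^sup>2"
    using prod x'' y'' by (simp split: if_splits)
  have low: "x mod P = y mod P"
    using prod P by (simp split: if_splits)
  have dbl: "x div P mod p\<^sup>2 div p = x div P mod p\<^sup>2 mod p"
      "y div P mod p\<^sup>2 div p = y div P mod p\<^sup>2 mod p"
    using prod p by (simp_all add: F split: if_splits)
  have Pi: "p ^ i = P * p"
    using i by (simp add: P_def power_eq_if)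
  have sq: "z mod p\<^sup>2 div p = z div p mod p" "z mod p\<^sup>2 mod p = z mod p" for z
    using p by (simp_all add: power2_eq_square mod_mult2_eq)
  show "digit p a (i - 1) = digit p a i" "digit p b (i - 1) = digit p b i"
    using dbl unfolding digit_def x_def[symmetric] y_def[symmetric] Pi P_def[symmetric] sq
      div_mult2_eq by simp_all
  fix j
  assume "j < i - 1 \<or> i < j"
  then show "digit p a j = digit p b j"
  proof
    assume j: "j < i - 1"
    \<comment> \<open>This makes \<open>P\<close> a multiple of \<open>p ^ Suc j\<close>, so digit
      \<open>j\<close> can be read off the remainder modulo \<open>P\<close>.\<close>
    then have "i - 1 = j + Suc (i - 1 - j - 1)"
      by simp
    then have "P = p ^ (j + Suc (i - 1 - j - 1))"
      unfolding P_def by (rule arg_cong)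
    also have "\<dots> = p ^ j * (p * p ^ (i - 1 - j - 1))"
      by (simp only: power_add power_Suc)
    finally have "P = p ^ j * (p * p ^ (i - 1 - j - 1))" .
    then have "z mod P div p ^ j mod p = z div p ^ j mod p" for z
      using p by (simp add: mod_mult2_eq[of z "p ^ j"] mod_mod_cancel)
    then show ?thesis
      using low unfolding digit_def x_def[symmetric] y_def[symmetric] by metis
  next
    assume j: "i < j"
    have "P * p\<^sup>2 * p ^ (j - i - 1) = p ^ (i - 1 + 2 + (j - i - 1))"
      by (simp only: P_def power_add)
    also have "i - 1 + 2 + (j - i - 1) = j"
      using i j by simp
    finally have "p ^ j = P * p\<^sup>2 * p ^ (j - i - 1)" ..
    then show ?thesis
      using high unfolding digit_def x_def[symmetric] y_def[symmetric]
      by (simp add: div_mult2_eq)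
  qed
qed

text \<open>The digits involved in \<open>h\<^sub>i\<^sub>,\<^sub>k\<close> are those at the (zero-based) positions \<open>i - k\<close> to \<open>i\<close>.\<close>

definition block_pair :: "nat \<Rightarrow> nat \<Rightarrow> nat \<Rightarrow> nat \<Rightarrow> nat \<Rightarrow> bool" where
  "block_pair p i k a b \<longleftrightarrow>
     digit p a (i - 1) = digit p a i \<and>
     digit p b (i - k) = digit p b (Suc (i - k)) \<and>
     (\<forall>j. i - k \<le> j \<and> Suc j < i \<longrightarrow> digit p a j = digit p b (j + 2)) \<and>
     (\<forall>j. j < i - k \<or> i < j \<longrightarrow> digit p a j = digit p b j)"

text \<open>Induction on \<open>k\<close>: appending \<open>h_rel p n (Suc r)\<close> with
  \<open>r = i - Suc k\<close> consumes the double digit of the intermediate \<open>c\<close> and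
  leaves a new one at \<open>r\<close> and \<open>Suc r\<close>, so each further digit of
  \<open>a\<close> reappears two places higher in \<open>b\<close>.\<close>

lemma block_rel_imp_block_pair:
  assumes "0 < p" and "i < n"
  shows "1 \<le> k \<Longrightarrow> k \<le> i \<Longrightarrow> (a, b) \<in> block_rel p n i k \<Longrightarrow>
    a \<in> {1..p ^ n} \<and> b \<in> {1..p ^ n} \<and> block_pair p i k a b"
proof (induction k arbitrary: b)
  case (Suc k)
  show ?case
  proof (cases k)
    case 0
    then show ?thesis
      using Suc.prems h_rel_digits[OF assms(1) _ assms(2), of a b]
      by (auto simp: block_pair_def)
  next
    case (Suc k')
    then obtain c where c: "(a, c) \<in> block_rel p n i k" "(c, b) \<in> h_rel p n (i - Suc k + 1)"
      using Suc.prems by auto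
    have IH: "a \<in> {1..p ^ n}" "block_pair p i k a c"
      using Suc.IH[OF _ _ c(1)] Suc Suc.prems by auto
    define r where "r = i - Suc k"
    have r: "i - k = Suc r" "i - Suc k + 1 = Suc r" "Suc r < n" "Suc r < i"
      using Suc Suc.prems assms(2) by (auto simp: r_def)
    have h: "b \<in> {1..p ^ n}" "digit p c r = digit p c (Suc r)"
        "digit p b r = digit p b (Suc r)"
        "\<And>j. j < r \<or> Suc r < j \<Longrightarrow> digit p c j = digit p b j"
      using h_rel_digits[OF assms(1) _ r(3) c(2)[unfolded r(2)]] by auto
    have sh: "digit p a (i - 1) = digit p a i"
        "digit p c (Suc r) = digit p c (Suc (Suc r))"
        "\<And>j. Suc r \<le> j \<Longrightarrow> Suc j < i \<Longrightarrow> digit p a j = digit p c (j + 2)"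
        "\<And>j. j < Suc r \<or> i < j \<Longrightarrow> digit p a j = digit p c j"
      using IH(2) unfolding block_pair_def r(1) by auto
    have "digit p a j = digit p b (j + 2)" if "r \<le> j" "Suc j < i" for j
    proof (cases "j = r")
      \<comment> \<open>The newly affected digit \<open>r\<close> of \<open>a\<close> is still that
        of \<open>c\<close>, where it equals the digits at \<open>Suc r\<close> and
        \<open>r + 2\<close>; the last of these passes unchanged to \<open>b\<close>.\<close>
      case True
      then show ?thesis
        using sh(4)[of r] h(2) sh(2) h(4)[of "Suc (Suc r)"] by simp
    next
      case False
      then show ?thesis
        using that sh(3)[of j] h(4)[of "j + 2"] by simp
    qed
    moreover have "digit p a j = digit p b j" if "j < r \<or> i < j" for j
      using that sh(4)[of j] h(4)[of j] r(4) by auto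
    ultimately show ?thesis
      using IH(1) h(1,3) sh(1) unfolding block_pair_def r_def[symmetric] by blast
  qed
qed simp

section \<open>Digits above the last index, and splitting off the last block\<close>

lemma block_rel_digits_above:
  assumes "0 < p" and "i < n" and "k \<le> i" and "(a, b) \<in> block_rel p n i k"
  shows "a \<in> {1..p ^ n} \<and> b \<in> {1..p ^ n} \<and> (\<forall>j > i. digit p a j = digit p b j)"
proof (cases k)
  case 0
  then show ?thesis
    using assms(4) by (auto simp: one_rel_eq)
next
  case (Suc k')
  then show ?thesis
    using block_rel_imp_block_pair[OF assms(1,2) _ assms(3,4)] by (auto simp: block_pair_def)
qed

text \<open>The recursion treats a single block separately; there the intermediate point is
  \<open>a\<close> itself, since the empty product is the identity on
  \<open>{1..p ^ n}\<close>.\<close>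

lemma product_rel_SucE:
  assumes "0 < p" and "1 < n" and "k 1 \<le> 1" and "(a, b) \<in> product_rel p n k (Suc m)"
  obtains c where "(a, c) \<in> product_rel p n k m" and "(c, b) \<in> block_rel p n (Suc m) (k (Suc m))"
proof (cases m)
  case 0
  then have "(a, b) \<in> block_rel p n (Suc 0) (k (Suc 0))"
    using assms(4) by simp
  moreover from this have "a \<in> {1..p ^ n}"
    using block_rel_digits_above[of p "Suc 0" n] assms(1-3) by auto
  ultimately show ?thesis
    using 0 that[of a] by (simp add: one_rel_eq Id_on_iff)
next
  case (Suc m')
  then show ?thesis
    using assms(4) that by auto
qed

lemma product_rel_digits_above:
  assumes "0 < p"
  shows "m < n \<Longrightarrow> \<forall>i\<in>{1..m}. k i \<le> i \<Longrightarrow> (a, b) \<in> product_rel p n k m \<Longrightarrow>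
    a \<in> {1..p ^ n} \<and> b \<in> {1..p ^ n} \<and> (\<forall>j > m. digit p a j = digit p b j)"
proof (induction m arbitrary: b)
  case 0
  then show ?case
    by (auto simp: one_rel_eq)
next
  case (Suc m)
  obtain c where c: "(a, c) \<in> product_rel p n k m" "(c, b) \<in> block_rel p n (Suc m) (k (Suc m))"
    using product_rel_SucE[of p n k a b m] assms Suc.prems by auto
  have "a \<in> {1..p ^ n} \<and> (\<forall>j > m. digit p a j = digit p c j)"
    using Suc.IH[of c] Suc.prems c(1) by auto
  moreover have "b \<in> {1..p ^ n} \<and> (\<forall>j > Suc m. digit p c j = digit p b j)"
    using block_rel_digits_above[OF assms _ _ c(2)] Suc.prems by auto
  ultimately show ?case
    by auto
qed

subsection \<open>Diagonals\<close>

text \<open>Allowing any length \<open>m\<close> lets the even and odd forms of a diagonal share one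
  formula.\<close>

definition alternating :: "'a \<Rightarrow> 'a \<Rightarrow> nat \<Rightarrow> 'a list" where
  "alternating x y m = map (\<lambda>j. if even j then x else y) [0..<m]"

lemma length_alternating [simp]: "length (alternating x y m) = m"
  by (simp add: alternating_def)

lemma nth_alternating [simp]:
  "j < m \<Longrightarrow> alternating x y m ! j = (if even j then x else y)"
  by (simp add: alternating_def)

lemma set_alternating: "set (alternating x y m) \<subseteq> {x, y}"
  by (auto simp: alternating_def)

lemma word_pow_eq_alternating: "word_pow ([x] @ [y]) l = alternating x y (2 * l)"
  by (induction l) (simp_all add: alternating_def)

lemma alternating_Suc_snoc:
  "alternating x y (Suc m) = alternating x y m @ [if even m then x else y]"
  by (simp add: alternating_def)

lemma alternating_Suc_Cons: "alternating x y (Suc m) = x # alternating y x m"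
  unfolding alternating_def map_upt_Suc by auto

text \<open>Up to exchanging the two letters, the four forms are one: the left word alternates and
  doubles its last letter, the right word doubles its first letter and then alternates. Here
  \<open>x\<close> is the letter following \<open>V\<close> on the left.\<close>

lemma block_diagonalE:
  assumes "block_diagonal p n q1 q2 i k d" and "0 < k"
  obtains x y V W where "{x, y} = {q1, q2}" and "k \<le> i"
    and "V \<in> S_words p (i - k)" and "W \<in> S_words p (n - i - 1)"
    and "d = (word_val p (V @ alternating x y k @ [if even k then y else x] @ W),
              word_val p (V @ [y] @ alternating y x k @ W))"
  using assms(1)
proof cases
  case zero
  then show ?thesis
    using assms(2) by simp
next
  case (even_RL l L R V W)
  then show ?thesis
    by (intro that[of q2 q1 V W]) (auto simp: word_pow_eq_alternating[simplified])
next
  case (even_LR l L R V W)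
  then show ?thesis
    by (intro that[of q1 q2 V W]) (auto simp: word_pow_eq_alternating[simplified])
next
  case (odd_LR l L R V W)
  then show ?thesis
    by (intro that[of q1 q2 V W])
      (auto simp: word_pow_eq_alternating[simplified] alternating_Suc_snoc[of q1]
        alternating_Suc_Cons[of q2])
next
  case (odd_RL l L R V W)
  then show ?thesis
    by (intro that[of q2 q1 V W])
      (auto simp: word_pow_eq_alternating[simplified] alternating_Suc_snoc[of q2]
        alternating_Suc_Cons[of q1])
qed

text \<open>All claims are read off the two words. The last two go beyond \<open>block_pair\<close>:
  they are what will exclude a smaller exponent.\<close>

lemma block_diagonal_pos:
  assumes "2 \<le> p" and q: "q1 \<in> {1..p}" "q2 \<in> {1..p}" "q1 \<noteq> q2"
    and "i < n" and "0 < k" and d: "block_diagonal p n q1 q2 i k (a, b)"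
  shows "a \<in> {1..p ^ n}" and "b \<in> {1..p ^ n}" and "block_pair p i k a b"
    and "digit p a i \<noteq> digit p b i"
    and "\<And>j. i - k < j \<Longrightarrow> j < i \<Longrightarrow> digit p b j \<noteq> digit p b (Suc j)"
proof -
  obtain x y V W where xy: "{x, y} = {q1, q2}" and k: "k \<le> i"
    and V: "V \<in> S_words p (i - k)" and W: "W \<in> S_words p (n - i - 1)"
    and ab: "a = word_val p (V @ alternating x y k @ [if even k then y else x] @ W)"
            "b = word_val p (V @ [y] @ alternating y x k @ W)"
    using block_diagonalE[OF d \<open>0 < k\<close>] by (metis Pair_inject)
  define A where "A = V @ alternating x y k @ [if even k then y else x] @ W"
  define B where "B = V @ [y] @ alternating y x k @ W"
  have q': "x \<in> {1..p}" "y \<in> {1..p}" "x \<noteq> y"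
    using xy q by (auto simp: doubleton_eq_iff)
  have VW: "length V = i - k" "set V \<subseteq> {1..p}" "length W = n - i - 1" "set W \<subseteq> {1..p}"
    using V W by (auto simp: S_words_def)
  have len: "length A = n" "length B = n"
    using VW k \<open>i < n\<close> by (auto simp: A_def B_def)
  have sub: "set A \<subseteq> {1..p}" "set B \<subseteq> {1..p}"
    using VW q' set_alternating[of x y k] set_alternating[of y x k]
    unfolding A_def B_def by auto
  show "a \<in> {1..p ^ n}" "b \<in> {1..p ^ n}"
    using word_val_range[OF assms(1) sub(1)] word_val_range[OF assms(1) sub(2)] len
    unfolding ab A_def[symmetric] B_def[symmetric] by simp_all
  have neq: "x - 1 \<noteq> y - 1"
    using q' by auto
  have dA: "digit p a j = A ! j - 1" and dB: "digit p b j = B ! j - 1" if "j < n" for j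
    using digit_word_val[OF assms(1) sub(1), of j] digit_word_val[OF assms(1) sub(2), of j]
      that len unfolding ab A_def[symmetric] B_def[symmetric] by simp_all
  have Am: "A ! (i - k + j) = (if even j then x else y)" if "j < k" for j
    using that unfolding A_def VW(1)[symmetric] nth_append_length_plus
    by (simp add: nth_append)
  have "A ! (i - k + k) = (if even k then y else x)"
    unfolding A_def VW(1)[symmetric] nth_append_length_plus by (simp add: nth_append)
  then have Ak: "A ! i = (if even k then y else x)"
    using k by simp
  have B0: "B ! (i - k) = y"
    using VW unfolding B_def by (simp add: nth_append)
  have Bm: "B ! (i - k + Suc j) = (if even j then y else x)" if "j < k" for j
    using that unfolding B_def VW(1)[symmetric] nth_append_length_plus
    by (simp add: nth_append)
  have out: "digit p a j = digit p b j" if "j < i - k \<or> i < j" for j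
  proof (cases "j < n")
    case True
    from that have "A ! j = B ! j"
    proof
      assume "j < i - k"
      then show ?thesis
        unfolding A_def B_def VW(1)[symmetric] by (simp add: nth_append)
    next
      assume "i < j"
      then obtain m where m: "j = Suc i + m"
        using less_imp_Suc_add by auto
      have "(V @ alternating x y k @ [if even k then y else x]) @ W = A"
        "(V @ [y] @ alternating y x k) @ W = B"
        by (simp_all add: A_def B_def)
      moreover have "length (V @ alternating x y k @ [if even k then y else x]) = Suc i"
        "length (V @ [y] @ alternating y x k) = Suc i"
        using VW(1) k by simp_all
      ultimately show ?thesis
        unfolding m by (metis nth_append_length_plus)
    qed
    then show ?thesis
      using True by (simp add: dA dB)
  next
    case False
    \<comment> \<open>Beyond the word length both digits are zero.\<close>
    have "p ^ n \<le> p ^ j"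
      using False assms(1) by (intro power_increasing) auto
    then have "a - 1 < p ^ j" "b - 1 < p ^ j"
      using \<open>a \<in> {1..p ^ n}\<close> \<open>b \<in> {1..p ^ n}\<close> by auto
    then show ?thesis
      by (simp add: digit_def)
  qed
  have "digit p a (i - 1) = digit p a i"
    using Am[of "k - 1"] Ak \<open>0 < k\<close> k \<open>i < n\<close> by (auto simp: dA)
  moreover have "digit p b (i - k) = digit p b (Suc (i - k))"
    using B0 Bm[of 0] \<open>0 < k\<close> k \<open>i < n\<close> by (auto simp: dB)
  moreover have "digit p a j = digit p b (j + 2)" if "i - k \<le> j" "Suc j < i" for j
    using that Am[of "j - (i - k)"] Bm[of "Suc (j - (i - k))"] k \<open>i < n\<close> by (auto simp: dA dB)
  ultimately show "block_pair p i k a b"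
    using out by (auto simp: block_pair_def)
  show "digit p a i \<noteq> digit p b i"
    using Ak Bm[of "k - 1"] \<open>0 < k\<close> k \<open>i < n\<close> neq by (auto simp: dA dB split: if_splits)
  show "digit p b j \<noteq> digit p b (Suc j)" if "i - k < j" "j < i" for j
  proof -
    \<comment> \<open>The alternating part of the right word starts at \<open>i - k + 1\<close>, so
      \<open>m\<close> is the index of position \<open>j\<close> within it.\<close>
    define m where "m = j - (i - k) - 1"
    have "j = i - k + Suc m" "Suc j = i - k + Suc (Suc m)" "Suc m < k" "Suc j < n"
      using that k \<open>i < n\<close> by (auto simp: m_def)
    then show ?thesis
      using Bm[of m] Bm[of "Suc m"] neq by (auto simp: dB)
  qed
qed

lemma block_diagonal_digits_above:
  assumes "2 \<le> p" and "q1 \<in> {1..p}" and "q2 \<in> {1..p}" and "q1 \<noteq> q2"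
    and "i < n" and "block_diagonal p n q1 q2 i k (a, b)" and "i < j"
  shows "digit p a j = digit p b j"
proof (cases "k = 0")
  case True
  from assms(6) show ?thesis
    by cases (use True in \<open>auto simp: one_rel_eq\<close>)
next
  case False
  then show ?thesis
    using block_diagonal_pos(3)[OF assms(1-5) _ assms(6)] assms(7) by (auto simp: block_pair_def)
qed

text \<open>The inductive definition has no empty product; the disjunct with \<open>m = 0\<close>
  stands in for the identity.\<close>

lemma product_diagonal_SucE:
  assumes "product_diagonal p n q1 q2 k (Suc m) (a, b)"
  obtains c where "m = 0 \<and> a = c \<or> product_diagonal p n q1 q2 k m (a, c)"
    and "block_diagonal p n q1 q2 (Suc m) (k (Suc m)) (c, b)"
  using assms
proof cases
  case first
  then show ?thesis
    using that[of a] by simp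
next
  case (step j c)
  then show ?thesis
    using that[of c] by simp
qed

lemma product_diagonal_digits_above:
  assumes "2 \<le> p" and "q1 \<in> {1..p}" and "q2 \<in> {1..p}" and "q1 \<noteq> q2"
  shows "product_diagonal p n q1 q2 k m (a, b) \<Longrightarrow> m < n \<Longrightarrow> m < j \<Longrightarrow> digit p a j = digit p b j"
proof (induction m arbitrary: b)
  case 0
  from "0.prems"(1) show ?case
    by cases simp_all
next
  case (Suc m)
  obtain c where c: "m = 0 \<and> a = c \<or> product_diagonal p n q1 q2 k m (a, c)"
    "block_diagonal p n q1 q2 (Suc m) (k (Suc m)) (c, b)"
    using product_diagonal_SucE[OF Suc.prems(1)] .
  show ?case
    using c(1) Suc.IH[of c] Suc.prems block_diagonal_digits_above[OF assms _ c(2), of j] by auto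
qed

section \<open>Comparing a diagonal with a pair that has the same right end\<close>

text \<open>For \<open>0 < k\<close>, \<open>block_pair\<close> fixes every digit of the left end
  from \<open>b\<close> except the equal digits at \<open>i - 1\<close> and \<open>i\<close>, and
  \<open>top\<close> settles those.\<close>

lemma block_diagonal_unique_left:
  assumes "2 \<le> p" and "q1 \<in> {1..p}" and "q2 \<in> {1..p}" and "q1 \<noteq> q2"
    and "i < n" and "k \<le> i" and d: "block_diagonal p n q1 q2 i k (a, b)"
    and r: "(a', b) \<in> block_rel p n i k" and top: "digit p a' i = digit p a i"
  shows "a' = a"
proof (cases "k = 0")
  case True
  from d have "a = b"
    by cases (use True in \<open>auto simp: one_rel_eq\<close>)
  then show ?thesis
    using r True by (auto simp: one_rel_eq)
next
  case False
  then have a: "a \<in> {1..p ^ n}" "block_pair p i k a b"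
    using block_diagonal_pos[OF assms(1-5) _ d] by auto
  have a': "a' \<in> {1..p ^ n}" "block_pair p i k a' b"
    using block_rel_imp_block_pair[OF _ \<open>i < n\<close> _ \<open>k \<le> i\<close> r] False assms(1) by auto
  have "digit p a' j = digit p a j" for j
  proof -
    consider "j < i - k \<or> i < j" | "i - k \<le> j" "Suc j < i" | "j = i - 1" | "j = i"
      by linarith
    then show ?thesis
      using a(2) a'(2) top unfolding block_pair_def by cases auto
  qed
  then show ?thesis
    using digits_eq_imp_eq a(1) a'(1) by blast
qed

text \<open>If \<open>k' = 0\<close>, then \<open>a' = b\<close>, whose digit \<open>i\<close>
  differs from that of \<open>a\<close>. Otherwise \<open>b\<close> has equal digits at
  \<open>i - k'\<close> and the next position, although \<open>i - k < i - k' < i\<close> lies in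
  its alternating part.\<close>

lemma block_diagonal_not_smaller:
  assumes "2 \<le> p" and "q1 \<in> {1..p}" and "q2 \<in> {1..p}" and "q1 \<noteq> q2"
    and "i < n" and "k \<le> i" and "k' < k" and d: "block_diagonal p n q1 q2 i k (a, b)"
    and r: "(a', b) \<in> block_rel p n i k'" and top: "digit p a' i = digit p a i"
  shows False
proof (cases "k' = 0")
  case True
  then show ?thesis
    using r top block_diagonal_pos(4)[OF assms(1-5) _ d] \<open>k' < k\<close> by (auto simp: one_rel_eq)
next
  case False
  then have "digit p b (i - k') = digit p b (Suc (i - k'))"
    using block_rel_imp_block_pair[OF _ \<open>i < n\<close> _ _ r] assms(1,6,7)
    by (auto simp: block_pair_def)
  then show ?thesis
    using block_diagonal_pos(5)[OF assms(1-5) _ d, of "i - k'"] False assms(6,7) by auto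
qed

text \<open>Induction on the number \<open>m\<close> of blocks, removing the last one;
  \<open>b\<close> varies because the hypothesis is applied to the intermediate point.\<close>

lemma product_diagonal_not_in_product_rel:
  assumes "2 \<le> p" and q: "q1 \<in> {1..p}" "q2 \<in> {1..p}" "q1 \<noteq> q2"
  shows "m < n \<Longrightarrow> \<forall>j\<in>{1..m}. k j \<le> j \<Longrightarrow> \<forall>j\<in>{1..m}. k' j \<le> j \<Longrightarrow>
    i \<in> {1..m} \<Longrightarrow> k' i < k i \<Longrightarrow> \<forall>j\<in>{i<..m}. k' j = k j \<Longrightarrow>
    product_diagonal p n q1 q2 k m (a, b) \<Longrightarrow> (a, b) \<notin> product_rel p n k' m"
proof (induction m arbitrary: b)
  case (Suc m)
  show ?case
  proof
    assume "(a, b) \<in> product_rel p n k' (Suc m)"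
    then obtain c' where c': "(a, c') \<in> product_rel p n k' m"
      "(c', b) \<in> block_rel p n (Suc m) (k' (Suc m))"
      using product_rel_SucE[of p n k' a b m] assms(1) Suc.prems by auto
    obtain c where c: "m = 0 \<and> a = c \<or> product_diagonal p n q1 q2 k m (a, c)"
      "block_diagonal p n q1 q2 (Suc m) (k (Suc m)) (c, b)"
      using product_diagonal_SucE[OF Suc.prems(7)] .
    \<comment> \<open>Both factorisations start at \<open>a\<close>, and their first
      \<open>m\<close> blocks leave digit \<open>Suc m\<close> unchanged.\<close>
    have "digit p c' (Suc m) = digit p a (Suc m)"
      using product_rel_digits_above[OF _ _ _ c'(1)] assms(1) Suc.prems by auto
    also have "\<dots> = digit p c (Suc m)"
      using c(1) product_diagonal_digits_above[OF assms, of n k m a c "Suc m"] Suc.prems by auto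
    finally have top: "digit p c' (Suc m) = digit p c (Suc m)" .
    show False
    proof (cases "i = Suc m")
      case True
      then show False
        using block_diagonal_not_smaller[OF assms _ _ _ c(2) c'(2) top] Suc.prems by auto
    next
      case False
      then have "k' (Suc m) = k (Suc m)"
        using Suc.prems by auto
      then have "c' = c"
        using block_diagonal_unique_left[OF assms _ _ c(2) _ top] c'(2) Suc.prems by auto
      \<comment> \<open>Here \<open>i\<close> lies in \<open>{1..m}\<close>, which rules out the
        disjunct with \<open>m = 0\<close>.\<close>
      moreover have "product_diagonal p n q1 q2 k m (a, c)"
        using c(1) False Suc.prems by auto
      ultimately show False
        using Suc.IH[of c] c'(1) Suc.prems False by auto
    qed
  qed
qed simp

theorem mainTheorem1:
  fixes n p q1 q2 :: nat and k k' :: "nat \<Rightarrow> nat"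
  assumes "n \<ge> 2" and "p \<ge> 2"
    and "q1 \<in> {1..p}" and "q2 \<in> {1..p}" and "q1 \<noteq> q2"
    and "normal_form n k" and "normal_form n k'"
    and "precedes n k' k"
  shows "\<forall>d. product_diagonal p n q1 q2 k (n - 1) d \<longrightarrow> d \<notin> product_rel p n k' (n - 1)"
proof (intro allI impI)
  fix d
  assume d: "product_diagonal p n q1 q2 k (n - 1) d"
  obtain a b where ab: "d = (a, b)"
    by (cases d)
  obtain i where "i \<in> {1..n - 1}" "k' i < k i" "\<forall>j\<in>{1..n - 1}. i < j \<longrightarrow> k' j = k j"
    using assms(8) by (auto simp: precedes_def)
  moreover have "\<forall>j\<in>{1..n - 1}. k j \<le> j" "\<forall>j\<in>{1..n - 1}. k' j \<le> j"
    using assms(6,7) by (auto simp: normal_form_def)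
  ultimately show "d \<notin> product_rel p n k' (n - 1)"
    using product_diagonal_not_in_product_rel[OF assms(2-5), of "n - 1" n k k' i a b] assms(1) d
    unfolding ab by auto
qed

end
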